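(* Let $\mathcal{C}$ be a permutation class that is sum closed and rc-invariant. Then $$\liminf_{n\to\infty}|\mathcal{C}^{rc}_{2n}|^{1/n}\;\ge\;\lim_{n\to\infty}|\mathcal{C}_n|^{1/n}.$$
   Context: A permutation of size $n$ is a bijection of $[n]$; $\pi$ contains $\sigma$ if some subsequence of $\pi$ has the same relative order as $\sigma$; a permutation class is a set of permutations closed downward under containment; $\mathcal{C}_n$ is the set of size-$n$ elements of $\mathcal{C}$. For $\pi$ of size $n$, $\mathrm{rc}(\pi)(i)=n+1-\pi(n+1-i)$; $\pi$ is centrosymmetric if $\mathrm{rc}(\pi)=\pi$; $\mathcal{C}^{rc}_n$ is the set of centrosymmetric elements of $\mathcal{C}_n$; $\mathcal{C}$ is rc-invariant if $\mathrm{rc}(\mathcal{C})=\mathcal{C}$. For $\sigma$ of size $a$ and $\tau$ of size $b$, the sum $\sigma\oplus\tau$ is the permutation of size $a+b$ with $(\sigma\oplus\tau)(i)=\sigma(i)$ for $i\le a$ and $(\sigma\oplus\tau)(i)=a+\tau(i-a)$ for $i>a$. $\mathcal{C}$ is sum closed if $\sigma,\tau\in\mathcal{C}$ implies $\sigma\oplus\tau\in\mathcal{C}$. (For sum closed classes the limit $\lim_n|\mathcal{C}_n|^{1/n}$ is known to exist.) *)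

theory Defs
  imports Complex_Main "HOL-Combinatorics.Permutations" "HOL-Library.Extended_Real"
begin

text \<open>
  A permutation is paired with its size, because \<^term>\<open>\<pi> permutes {1..n}\<close> alone does not determine
  \<^term>\<open>n\<close>. Since \<open>permutes\<close> fixes every point outside \<open>{1..n}\<close>, equality of such pairs is equality of
  bijections of \<open>{1..n}\<close>. The empty permutation, of size 0, is included.
\<close>

type_synonym sized_perm = "nat \<times> (nat \<Rightarrow> nat)"

definition is_perm :: "sized_perm \<Rightarrow> bool" where
  "is_perm p \<longleftrightarrow> snd p permutes {1..fst p}"

definition contains :: "sized_perm \<Rightarrow> sized_perm \<Rightarrow> bool" where
  "contains p q \<longleftrightarrow>
     (\<exists>f. strict_mono_on {1..fst q} f \<and> f ` {1..fst q} \<subseteq> {1..fst p} \<and>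
       (\<forall>i\<in>{1..fst q}. \<forall>j\<in>{1..fst q}. snd q i < snd q j \<longleftrightarrow> snd p (f i) < snd p (f j)))"

definition permutation_class :: "sized_perm set \<Rightarrow> bool" where
  "permutation_class C \<longleftrightarrow>
     (\<forall>p\<in>C. is_perm p) \<and> (\<forall>p\<in>C. \<forall>q. is_perm q \<and> contains p q \<longrightarrow> q \<in> C)"

definition of_size :: "sized_perm set \<Rightarrow> nat \<Rightarrow> sized_perm set" where
  "of_size C n = {p \<in> C. fst p = n}"

definition rc :: "sized_perm \<Rightarrow> sized_perm" where
  "rc p = (fst p, \<lambda>i. if i \<in> {1..fst p} then fst p + 1 - snd p (fst p + 1 - i) else i)"

definition centrosymmetric :: "sized_perm \<Rightarrow> bool" where
  "centrosymmetric p \<longleftrightarrow> rc p = p"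

definition centrosymmetric_of_size :: "sized_perm set \<Rightarrow> nat \<Rightarrow> sized_perm set" where
  "centrosymmetric_of_size C n = {p \<in> of_size C n. centrosymmetric p}"

definition rc_invariant :: "sized_perm set \<Rightarrow> bool" where
  "rc_invariant C \<longleftrightarrow> rc ` C = C"

text \<open>Points beyond the total size need no separate case: there the second summand is the identity.\<close>

definition perm_sum :: "sized_perm \<Rightarrow> sized_perm \<Rightarrow> sized_perm" where
  "perm_sum p q =
     (fst p + fst q, \<lambda>i. if i \<le> fst p then snd p i else fst p + snd q (i - fst p))"

definition sum_closed :: "sized_perm set \<Rightarrow> bool" where
  "sum_closed C \<longleftrightarrow> (\<forall>p\<in>C. \<forall>q\<in>C. perm_sum p q \<in> C)"

end

theory Submission imports Defs "HOL-Real_Asymp.Real_Asymp" begin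

text \<open>
  The map \<open>\<pi> \<mapsto> \<pi> \<oplus> rc(\<pi>)\<close> is injective, and \<open>rc\<close> is an involution satisfying
  \<open>rc(\<sigma> \<oplus> \<tau>) = rc(\<tau>) \<oplus> rc(\<sigma>)\<close>, so the class has at least as many centrosymmetric elements of size \<open>2n\<close>
  as elements of size \<open>n\<close>. The growth rate exists because direct sums make the counting sequence
  supermultiplicative, so Fekete's argument applies; the limit may be infinite.
\<close>

lemma supermultiplicative_power_le:
  fixes a :: "nat \<Rightarrow> 'a::ordered_semiring_1"
  assumes nonneg: "\<And>n. 0 \<le> a n" and super: "\<And>m n. a m * a n \<le> a (m + n)"
  shows "a m ^ q * a r \<le> a (q * m + r)"
proof (induction q)
  case (Suc q)
  have "a m ^ Suc q * a r = a m * (a m ^ q * a r)" by (simp add: mult.assoc)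
  also have "\<dots> \<le> a m * a (q * m + r)"
    by (intro mult_left_mono Suc.IH nonneg)
  also have "\<dots> \<le> a (m + (q * m + r))" by (rule super)
  finally show ?case by (simp add: add.assoc)
qed simp

lemma root_power_div_tendsto:
  fixes x :: real
  assumes "0 < m" "0 < x"
  shows "(\<lambda>n. root n (x ^ (n div m))) \<longlonglongrightarrow> root m x"
proof -
  have "(\<lambda>n. real_of_int \<lfloor>real n / real m\<rfloor> / real n) \<longlonglongrightarrow> 1 / real m"
    using assms(1) by (real_asymp simp: inverse_eq_divide)
  then have "(\<lambda>n. real (n div m) / real n) \<longlonglongrightarrow> 1 / real m"
    by (simp add: floor_divide_of_nat_eq)
  then have "(\<lambda>n. x powr (real (n div m) / real n)) \<longlonglongrightarrow> x powr (1 / real m)"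
    using assms(2) by (intro tendsto_powr tendsto_const) auto
  moreover have "\<forall>\<^sub>F n in sequentially. x powr (real (n div m) / real n) = root n (x ^ (n div m))"
    using eventually_gt_at_top[of 0]
    by eventually_elim
      (use assms(2) in \<open>simp add: root_powr_inverse powr_powr flip: powr_realpow\<close>)
  ultimately have "(\<lambda>n. root n (x ^ (n div m))) \<longlonglongrightarrow> x powr (1 / real m)"
    by (rule Lim_transform_eventually)
  then show ?thesis
    using assms by (simp add: root_powr_inverse)
qed

lemma supermultiplicative_root_le_liminf:
  fixes a :: "nat \<Rightarrow> real"
  assumes pos: "\<And>n. 0 < a n" and super: "\<And>m n. a m * a n \<le> a (m + n)" and "0 < m"
  shows "ereal (root m (a m)) \<le> liminf (\<lambda>n. ereal (root n (a n)))"
proof -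
  define min_remainder where "min_remainder = Min (a ` {..<m})"
  have "0 < min_remainder"
    using \<open>0 < m\<close> pos unfolding min_remainder_def by (subst Min_gr_iff) auto
  have lower: "root n (a m ^ (n div m)) * root n min_remainder \<le> root n (a n)" if "0 < n" for n
  proof -
    have "a m ^ (n div m) * min_remainder \<le> a m ^ (n div m) * a (n mod m)"
      using \<open>0 < m\<close> pos[of m] by (intro mult_left_mono) (auto simp: min_remainder_def)
    also have "\<dots> \<le> a (n div m * m + n mod m)"
      by (intro supermultiplicative_power_le less_imp_le pos super)
    finally show ?thesis
      using \<open>0 < n\<close> by (simp flip: real_root_mult)
  qed
  have "(\<lambda>n. root n (a m ^ (n div m)) * root n min_remainder) \<longlonglongrightarrow> root m (a m) * 1"
    using \<open>0 < m\<close> \<open>0 < min_remainder\<close> pos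
    by (intro tendsto_mult root_power_div_tendsto LIMSEQ_root_const)
  then have "ereal (root m (a m))
      = liminf (\<lambda>n. ereal (root n (a m ^ (n div m)) * root n min_remainder))"
    by (intro lim_imp_Liminf[symmetric]) auto
  also have "\<dots> \<le> liminf (\<lambda>n. ereal (root n (a n)))"
    using lower by (intro Liminf_mono eventually_mono[OF eventually_gt_at_top[of 0]]) auto
  finally show ?thesis .
qed

text \<open>The index \<open>0\<close> does not affect the supremum because \<^term>\<open>root 0 x = 0\<close>.\<close>

lemma supermultiplicative_root_tendsto_SUP:
  fixes a :: "nat \<Rightarrow> real"
  assumes pos: "\<And>n. 0 < a n" and super: "\<And>m n. a m * a n \<le> a (m + n)"
  shows "(\<lambda>n. ereal (root n (a n))) \<longlonglongrightarrow> (SUP n. ereal (root n (a n)))"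
    (is "?r \<longlonglongrightarrow> ?S")
proof -
  have "?r m \<le> liminf ?r" for m
  proof (cases "m = 0")
    case True
    then show ?thesis
      using pos
      by (auto intro!: Liminf_bounded always_eventually simp: less_imp_le real_root_ge_zero)
  next
    case False
    then show ?thesis
      by (intro supermultiplicative_root_le_liminf pos super) simp
  qed
  then have "?S \<le> liminf ?r" by (rule SUP_least)
  moreover have "limsup ?r \<le> ?S"
    by (intro Limsup_bounded always_eventually allI SUP_upper UNIV_I)
  moreover have "liminf ?r \<le> limsup ?r"
    by (rule Liminf_le_Limsup) simp
  ultimately show ?thesis
    by (intro Liminf_eq_Limsup antisym) auto
qed

lemma is_perm_fixes: "is_perm p \<Longrightarrow> i \<notin> {1..fst p} \<Longrightarrow> snd p i = i"
  by (simp add: is_perm_def permutes_not_in)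

lemma is_perm_le:
  assumes "is_perm p" "i \<le> fst p"
  shows "snd p i \<le> fst p"
proof (cases "i = 0")
  case True
  then show ?thesis using is_perm_fixes[OF assms(1), of i] by simp
next
  case False
  then show ?thesis
    using assms permutes_in_image[of "snd p" "{1..fst p}" i] by (simp add: is_perm_def)
qed

lemma rc_rc:
  assumes "is_perm p"
  shows "rc (rc p) = p"
proof (rule prod_eqI)
  show "snd (rc (rc p)) = snd p"
    using is_perm_le[OF assms] is_perm_fixes[OF assms]
    by (auto simp: rc_def fun_eq_iff le_SucI)
qed (simp add: rc_def)

lemma rc_perm_sum:
  assumes "is_perm p"
  shows "rc (perm_sum p q) = perm_sum (rc q) (rc p)"
proof (rule prod_eqI)
  let ?k = "fst p" and ?l = "fst q"
  have "snd (rc (perm_sum p q)) i = snd (perm_sum (rc q) (rc p)) i" for i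
  proof -
    consider (outside) "i \<notin> {1..?k + ?l}" | (first_block) "1 \<le> i" "i \<le> ?l"
      | (second_block) "?l < i" "i \<le> ?k + ?l"
      by fastforce
    then show ?thesis
    proof cases
      case outside
      then show ?thesis by (auto simp: rc_def perm_sum_def)
    next
      case first_block
      then have "?k + ?l + 1 - i - ?k = ?l + 1 - i" "\<not> ?k + ?l + 1 - i \<le> ?k" by linarith+
      with first_block show ?thesis by (simp add: rc_def perm_sum_def)
    next
      case second_block
      then have "?k + 1 - (i - ?l) = ?k + ?l + 1 - i" "?k + ?l + 1 - i \<le> ?k" by linarith+
      with second_block is_perm_le[OF assms, of "?k + ?l + 1 - i"] show ?thesis
        by (auto simp: rc_def perm_sum_def)
    qed
  qed
  then show "snd (rc (perm_sum p q)) = snd (perm_sum (rc q) (rc p))" by (rule ext)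
qed (simp add: rc_def perm_sum_def)

lemma centrosymmetric_perm_sum_rc: "is_perm p \<Longrightarrow> centrosymmetric (perm_sum p (rc p))"
  by (simp add: centrosymmetric_def rc_perm_sum rc_rc)

lemma perm_sum_inject:
  assumes perm: "is_perm p" "is_perm q" "is_perm p'" "is_perm q'" and "fst p = fst p'"
  shows "perm_sum p q = perm_sum p' q' \<longleftrightarrow> p = p' \<and> q = q'"
proof
  have snd_left: "snd p i = (if i \<le> fst p then snd (perm_sum p q) i else i)"
    if "is_perm p" for p q i
    using is_perm_fixes[OF that] by (simp add: perm_sum_def)
  have snd_right: "snd q i = snd (perm_sum p q) (fst p + i) - fst p"
    if "is_perm p" "is_perm q" for p q i
    using is_perm_fixes[OF that(2), of i] is_perm_le[OF that(1), of "fst p"]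
    by (cases "i = 0") (auto simp: perm_sum_def)
  assume eq: "perm_sum p q = perm_sum p' q'"
  have "snd p = snd p'" "snd q = snd q'"
    using snd_left[OF perm(1), of _ q] snd_left[OF perm(3), of _ q'] snd_right[OF perm(1,2)]
      snd_right[OF perm(3,4)] eq \<open>fst p = fst p'\<close> by (simp_all add: fun_eq_iff)
  moreover have "fst q = fst q'"
    using arg_cong[OF eq, of fst] \<open>fst p = fst p'\<close> by (simp add: perm_sum_def)
  ultimately show "p = p' \<and> q = q'"
    using \<open>fst p = fst p'\<close> by (simp add: prod_eq_iff)
qed simp

lemma contains_size_le_1: "fst q \<le> 1 \<Longrightarrow> fst q \<le> fst p \<Longrightarrow> contains p q"
  by (cases "fst q = 0")
    (auto simp: contains_def strict_mono_on_def le_Suc_eq intro!: exI[of _ id])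

lemma permutation_class_is_perm: "permutation_class C \<Longrightarrow> p \<in> C \<Longrightarrow> is_perm p"
  by (simp add: permutation_class_def)

lemma permutation_class_contains:
  "permutation_class C \<Longrightarrow> p \<in> C \<Longrightarrow> is_perm q \<Longrightarrow> contains p q \<Longrightarrow> q \<in> C"
  unfolding permutation_class_def by blast

lemma finite_of_size:
  assumes "permutation_class C"
  shows "finite (of_size C n)"
proof (rule finite_subset)
  show "of_size C n \<subseteq> {n} \<times> {p. p permutes {1..n}}"
    using permutation_class_is_perm[OF assms] by (auto simp: of_size_def is_perm_def)
qed (simp add: finite_permutations)

lemma perm_sum_of_size:
  "sum_closed C \<Longrightarrow> p \<in> of_size C m \<Longrightarrow> q \<in> of_size C n \<Longrightarrow> perm_sum p q \<in> of_size C (m + n)"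
  by (auto simp: of_size_def sum_closed_def) (simp_all add: perm_sum_def)

lemma rc_of_size: "rc_invariant C \<Longrightarrow> p \<in> of_size C n \<Longrightarrow> rc p \<in> of_size C n"
  by (auto simp: of_size_def rc_invariant_def rc_def)

lemma of_size_nonempty:
  assumes perm_class: "permutation_class C" and closed: "sum_closed C"
    and mem: "p \<in> C" and nonempty: "0 < fst p"
  shows "of_size C n \<noteq> {}"
proof -
  have id_mem: "(k, id) \<in> of_size C k" if "k \<le> 1" for k
  proof -
    have "contains p (k, id)" using that nonempty by (simp add: contains_size_le_1)
    then have "(k, id) \<in> C"
      by (intro permutation_class_contains[OF perm_class mem]) (simp_all add: is_perm_def)
    then show ?thesis by (simp add: of_size_def)
  qed
  show ?thesis
  proof (induction n)
    case 0
    show ?case using id_mem[of 0] by auto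
  next
    case (Suc n)
    then obtain q where "q \<in> of_size C n" by blast
    then have "perm_sum (1, id) q \<in> of_size C (1 + n)"
      by (intro perm_sum_of_size[OF closed id_mem]) simp_all
    then show ?case by auto
  qed
qed

lemma card_of_size_supermultiplicative:
  assumes perm_class: "permutation_class C" and closed: "sum_closed C"
  shows "card (of_size C m) * card (of_size C n) \<le> card (of_size C (m + n))"
proof -
  have "inj_on (\<lambda>(p, q). perm_sum p q) (of_size C m \<times> of_size C n)"
    using permutation_class_is_perm[OF perm_class]
    by (auto simp: inj_on_def of_size_def perm_sum_inject)
  moreover have "(\<lambda>(p, q). perm_sum p q) ` (of_size C m \<times> of_size C n) \<subseteq> of_size C (m + n)"
    using perm_sum_of_size[OF closed] by auto
  ultimately have "card (of_size C m \<times> of_size C n) \<le> card (of_size C (m + n))"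
    by (rule card_inj_on_le) (rule finite_of_size[OF perm_class])
  then show ?thesis by (simp add: card_cartesian_product)
qed

lemma root_card_of_size_tendsto_SUP:
  assumes perm_class: "permutation_class C" and closed: "sum_closed C"
  shows "(\<lambda>n. ereal (root n (card (of_size C n))))
    \<longlonglongrightarrow> (SUP n. ereal (root n (card (of_size C n))))"
proof (cases "\<exists>p\<in>C. 0 < fst p")
  case True
  then have "0 < card (of_size C n)" for n
    using of_size_nonempty[OF perm_class closed] finite_of_size[OF perm_class]
    by (auto simp: card_gt_0_iff)
  moreover have "real (card (of_size C m)) * real (card (of_size C n))
      \<le> real (card (of_size C (m + n)))" for m n
    using card_of_size_supermultiplicative[OF perm_class closed] by (simp flip: of_nat_mult)
  ultimately show ?thesis
    by (intro supermultiplicative_root_tendsto_SUP) auto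
next
  case False
  then have "of_size C n = {}" if "0 < n" for n
    using that by (auto simp: of_size_def)
  then have "root n (card (of_size C n)) = 0" for n
    by (cases "n = 0") auto
  then show ?thesis by simp
qed

lemma card_of_size_le_card_centrosymmetric:
  assumes perm_class: "permutation_class C" and closed: "sum_closed C"
    and rc_inv: "rc_invariant C"
  shows "card (of_size C n) \<le> card (centrosymmetric_of_size C (2 * n))"
proof (rule card_inj_on_le)
  have perm: "is_perm p" if "p \<in> of_size C n" for p
    using that permutation_class_is_perm[OF perm_class] by (simp add: of_size_def)
  have rc: "rc p \<in> of_size C n" if "p \<in> of_size C n" for p
    using that by (rule rc_of_size[OF rc_inv])
  show "inj_on (\<lambda>p. perm_sum p (rc p)) (of_size C n)"
  proof (rule inj_onI)
    fix p q
    assume mem: "p \<in> of_size C n" "q \<in> of_size C n"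
      and eq: "perm_sum p (rc p) = perm_sum q (rc q)"
    have "fst p = fst q"
      using mem by (simp add: of_size_def)
    then show "p = q"
      using eq mem by (simp add: perm_sum_inject perm rc)
  qed
  show "(\<lambda>p. perm_sum p (rc p)) ` of_size C n \<subseteq> centrosymmetric_of_size C (2 * n)"
    using perm_sum_of_size[OF closed _ rc] perm
    by (auto simp: centrosymmetric_of_size_def centrosymmetric_perm_sum_rc mult_2)
  show "finite (centrosymmetric_of_size C (2 * n))"
    using finite_of_size[OF perm_class] by (simp add: centrosymmetric_of_size_def)
qed

theorem theorem1p3:
  fixes C :: "sized_perm set"
  assumes "permutation_class C"
    and "sum_closed C"
    and "rc_invariant C"
  shows "liminf (\<lambda>n. ereal (root n (real (card (centrosymmetric_of_size C (2 * n))))))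
    \<ge> lim (\<lambda>n. ereal (root n (real (card (of_size C n)))))"
proof -
  have "root n (card (of_size C n)) \<le> root n (card (centrosymmetric_of_size C (2 * n)))" for n
    using card_of_size_le_card_centrosymmetric[OF assms, of n] by (cases "n = 0") simp_all
  then have "liminf (\<lambda>n. ereal (root n (card (of_size C n))))
      \<le> liminf (\<lambda>n. ereal (root n (card (centrosymmetric_of_size C (2 * n)))))"
    by (intro Liminf_mono always_eventually) simp
  moreover have "convergent (\<lambda>n. ereal (root n (card (of_size C n))))"
    using root_card_of_size_tendsto_SUP[OF assms(1,2)] by (rule convergentI)
  ultimately show ?thesis by (simp add: convergent_liminf_cl)
qed

end
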